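(* Let $n$ be any natural number and let $\varepsilon > 0$. There exist $b \in \mathbb{R}^n\setminus \mathbb{Z}^n$ and a family $\mathcal{F}$ of maximal $(b+\mathbb{Z}^n)$-free sets such that for any $B\in \mathcal{F}$ there exist a minimal lifting $\pi$ of $\psi_B$ and a point $p \in \mathbb{R}^n$ satisfying $$\frac{\pi(p)}{\widetilde{\psi_B}(p)} < \varepsilon .$$
   Context: Fix $n\in\mathbb{N}$ and $b\in\mathbb{R}^n\setminus\mathbb{Z}^n$. A $(b+\mathbb{Z}^n)$-free set is a closed convex set $B\subseteq\mathbb{R}^n$ with $0\in\operatorname{int}(B)$ and $\operatorname{int}(B)\cap(b+\mathbb{Z}^n)=\emptyset$. It is maximal if it is not strictly contained in another such set. The gauge function of a convex set $B$ with $0\in\operatorname{int}(B)$ is $\psi_B(x)=\inf\{\lambda>0 : x/\lambda\in B\}$. The trivial lifting of $\psi_B$ (for $B$ a maximal $(b+\mathbb{Z}^n)$-free set) is $$\widetilde{\psi_B}(x)=\min\Big(1,\ \inf_{z\in\mathbb{Z}^n}\psi_B(x+z)\Big).$$ For $k,\ell\in\mathbb{N}$, $R\in\mathbb{R}^{n\times k}$ with columns $r_1,\dots,r_k$ and $P\in\mathbb{R}^{n\times\ell}$ with columns $p_1,\dots,p_\ell$, let $$X(R,P)=\operatorname{conv}\{(s,y)\in\mathbb{R}^k_+\times\mathbb{Z}^\ell_+ : Rs+Py\in b+\mathbb{Z}^n\}.$$ A pair of functions $\psi,\pi:\mathbb{R}^n\to\mathbb{R}$ is a valid pair (for $b$)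 if for all $k,\ell,R,P$ the inequality $\sum_{i=1}^k\psi(r_i)s_i+\sum_{i=1}^\ell\pi(p_i)y_i\ge 1$ holds for all $(s,y)\in X(R,P)$. A lifting of $\psi_B$ is a function $\pi:\mathbb{R}^n\to\mathbb{R}$ such that $(\psi_B,\pi)$ is a valid pair. A lifting $\pi$ is minimal if there is no lifting $\pi'\ne\pi$ of $\psi_B$ with $\pi'\le\pi$ pointwise.
   Formalization: The dimension n is taken to be at least 2: for n = 0 no b exists, and for n = 1 every lifting is at least the trivial lifting, so the claim fails for ε ≤ 1; the family is required to be nonempty and the denominator nonzero. *)

theory Defs
  imports
    "HOL-Analysis.Analysis"
    "HOL-Analysis.Finite_Function_Topology"
begin

definition int_lattice :: "(real ^ 'n) set"
  where "int_lattice = {z. \<forall>i. z $ i \<in> \<int>}"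

abbreviation shifted_lattice :: "real ^ 'n \<Rightarrow> (real ^ 'n) set"
  where "shifted_lattice b \<equiv> (+) b ` int_lattice"

definition lattice_free :: "real ^ 'n \<Rightarrow> (real ^ 'n) set \<Rightarrow> bool"
  where "lattice_free b B \<longleftrightarrow>
    closed B \<and> convex B \<and> 0 \<in> interior B \<and> interior B \<inter> shifted_lattice b = {}"

definition maximal_lattice_free :: "real ^ 'n \<Rightarrow> (real ^ 'n) set \<Rightarrow> bool"
  where "maximal_lattice_free b B \<longleftrightarrow>
    lattice_free b B \<and> \<not> (\<exists>C. lattice_free b C \<and> B \<subset> C)"

text \<open>The infima below are meaningful real infima whenever \<open>0\<close> is an interior point of \<open>B\<close>:
  the sets are then nonempty, and they are bounded below by \<open>0\<close>.\<close>

definition gauge_function :: "(real ^ 'n) set \<Rightarrow> real ^ 'n \<Rightarrow> real"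
  where "gauge_function B x = Inf {t. t > 0 \<and> x /\<^sub>R t \<in> B}"

definition trivial_lifting :: "(real ^ 'n) set \<Rightarrow> real ^ 'n \<Rightarrow> real"
  where "trivial_lifting B x = min 1 (INF z\<in>int_lattice. gauge_function B (x + z))"

text \<open>The numbers of columns \<open>k\<close> and \<open>l\<close> have to be quantified inside the notion of a valid pair.
  So a matrix is given by its columns \<open>r i\<close> (\<open>i < k\<close>) and \<open>p j\<close> (\<open>j < l\<close>), and \<open>\<real>\<^sup>k\<close> is the
  subspace of those finitely supported functions \<open>nat \<Rightarrow>\<^sub>0 real\<close> with support in \<open>{..<k}\<close>;
  the type \<open>nat \<Rightarrow>\<^sub>0 real\<close> is a real vector space, so that the library's convex hull applies.\<close>

definition mixed_integer_set ::
  "real ^ 'n \<Rightarrow> nat \<Rightarrow> nat \<Rightarrow> (nat \<Rightarrow> real ^ 'n) \<Rightarrow> (nat \<Rightarrow> real ^ 'n) \<Rightarrow>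
    ((nat \<Rightarrow>\<^sub>0 real) \<times> (nat \<Rightarrow>\<^sub>0 real)) set"
  where "mixed_integer_set b k l r p =
    {(s, y). Poly_Mapping.keys s \<subseteq> {..<k} \<and> Poly_Mapping.keys y \<subseteq> {..<l} \<and>
       (\<forall>i<k. Poly_Mapping.lookup s i \<ge> 0) \<and> (\<forall>j<l. Poly_Mapping.lookup y j \<in> \<nat>) \<and>
       (\<Sum>i<k. Poly_Mapping.lookup s i *\<^sub>R r i) + (\<Sum>j<l. Poly_Mapping.lookup y j *\<^sub>R p j)
         \<in> shifted_lattice b}"

definition valid_pair :: "real ^ 'n \<Rightarrow> (real ^ 'n \<Rightarrow> real) \<Rightarrow> (real ^ 'n \<Rightarrow> real) \<Rightarrow> bool"
  where "valid_pair b \<psi> \<pi> \<longleftrightarrow>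
    (\<forall>k l r p. \<forall>(s, y) \<in> convex hull (mixed_integer_set b k l r p).
       (\<Sum>i<k. \<psi> (r i) * Poly_Mapping.lookup s i) + (\<Sum>j<l. \<pi> (p j) * Poly_Mapping.lookup y j) \<ge> 1)"

definition lifting :: "real ^ 'n \<Rightarrow> (real ^ 'n) set \<Rightarrow> (real ^ 'n \<Rightarrow> real) \<Rightarrow> bool"
  where "lifting b B \<pi> \<longleftrightarrow> valid_pair b (gauge_function B) \<pi>"

definition minimal_lifting :: "real ^ 'n \<Rightarrow> (real ^ 'n) set \<Rightarrow> (real ^ 'n \<Rightarrow> real) \<Rightarrow> bool"
  where "minimal_lifting b B \<pi> \<longleftrightarrow>
    lifting b B \<pi> \<and> \<not> (\<exists>\<pi>'. lifting b B \<pi>' \<and> \<pi>' \<noteq> \<pi> \<and> (\<forall>x. \<pi>' x \<le> \<pi> x))"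

end

theory Submission
  imports Defs
begin

text \<open>Let \<open>b = (1/2, \<dots>, 1/2)\<close> and let \<open>B\<close> be the parallelogram
  \<open>\<bar>x\<^sub>i - x\<^sub>j\<bar> \<le> 1\<close>, \<open>\<bar>(2 - e) x\<^sub>i + e x\<^sub>j\<bar> \<le> 1\<close>, extended to a cylinder; each of its four facets is
  blocked by a point with entries \<open>\<plusminus>1/2\<close>. For \<open>p\<close> half a unit vector in direction \<open>j\<close>, the facets
  that are steep in direction \<open>j\<close> keep every integer translate of \<open>p\<close> at gauge at least \<open>1/2\<close>.
  They lie at opposite ends of opposite sides \<open>x\<^sub>i = \<plusminus>1/2\<close>, so the points of \<open>b + \<int>\<^sup>n - N p\<close> have
  gauge at least \<open>1\<close> for \<open>N = 0\<close> and at least \<open>1 - e/2\<close> always. Hence the function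
  with value \<open>e/2\<close> at \<open>p\<close> and \<open>1\<close> elsewhere is a lifting, and Zorn's lemma gives a minimal lifting
  below it.\<close>

section \<open>Validity without the convex hull\<close>

lemma lookup_scaleR [simp]:
  "Poly_Mapping.lookup (t *\<^sub>R f) i = t *\<^sub>R Poly_Mapping.lookup f i"
proof -
  have "finite {i. t *\<^sub>R Poly_Mapping.lookup f i \<noteq> 0}"
    by (rule finite_subset[OF _ finite_keys[of f]]) (auto simp: in_keys_iff)
  then show ?thesis
    by (simp add: scaleR_poly_mapping_def)
qed

text \<open>The valid inequality is linear in \<open>(s, y)\<close>, so the convex hull plays no role.\<close>

lemma valid_pair_iff:
  "valid_pair b \<psi> \<pi> \<longleftrightarrow>
    (\<forall>k l r p (s :: nat \<Rightarrow> real) (y :: nat \<Rightarrow> nat).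
      (\<forall>i<k. s i \<ge> 0) \<longrightarrow>
      (\<Sum>i<k. s i *\<^sub>R r i) + (\<Sum>j<l. real (y j) *\<^sub>R p j) \<in> shifted_lattice b \<longrightarrow>
      1 \<le> (\<Sum>i<k. \<psi> (r i) * s i) + (\<Sum>j<l. \<pi> (p j) * real (y j)))"
    (is "_ \<longleftrightarrow> ?R")
proof
  assume V: "valid_pair b \<psi> \<pi>"
  show ?R
  proof (intro allI impI)
    fix k l r p and s :: "nat \<Rightarrow> real" and y :: "nat \<Rightarrow> nat"
    assume s: "\<forall>i<k. s i \<ge> 0"
      and mem: "(\<Sum>i<k. s i *\<^sub>R r i) + (\<Sum>j<l. real (y j) *\<^sub>R p j) \<in> shifted_lattice b"
    \<comment> \<open>Cutting \<open>s\<close> and \<open>y\<close> off outside the index range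
      makes the supports finite and puts the keys in \<open>{..<k}\<close> and
      \<open>{..<l}\<close>.\<close>
    define S where "S = Abs_poly_mapping (\<lambda>i. if i < k then s i else 0)"
    define Y where "Y = Abs_poly_mapping (\<lambda>j. if j < l then real (y j) else 0)"
    have S: "Poly_Mapping.lookup S = (\<lambda>i. if i < k then s i else 0)"
      unfolding S_def by (rule Abs_poly_mapping_inverse) simp
    have Y: "Poly_Mapping.lookup Y = (\<lambda>j. if j < l then real (y j) else 0)"
      unfolding Y_def by (rule Abs_poly_mapping_inverse) simp
    have "(S, Y) \<in> mixed_integer_set b k l r p"
      unfolding mixed_integer_set_def
      using s mem by (auto simp: S Y in_keys_iff split: if_splits)
    then have "(S, Y) \<in> convex hull (mixed_integer_set b k l r p)"
      by (rule hull_inc)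
    then have "1 \<le> (\<Sum>i<k. \<psi> (r i) * Poly_Mapping.lookup S i)
        + (\<Sum>j<l. \<pi> (p j) * Poly_Mapping.lookup Y j)"
      using V unfolding valid_pair_def by blast
    then show "1 \<le> (\<Sum>i<k. \<psi> (r i) * s i) + (\<Sum>j<l. \<pi> (p j) * real (y j))"
      by (simp add: S Y)
  qed
next
  assume R: ?R
  have "(\<Sum>i<k. \<psi> (r i) * Poly_Mapping.lookup s i) + (\<Sum>j<l. \<pi> (p j) * Poly_Mapping.lookup y j) \<ge> 1"
    if sy: "(s, y) \<in> convex hull (mixed_integer_set b k l r p)" for k l r p s y
  proof -
    define F where "F = (\<lambda>q. (\<Sum>i<k. \<psi> (r i) * Poly_Mapping.lookup (fst q) i)
        + (\<Sum>j<l. \<pi> (p j) * Poly_Mapping.lookup (snd q) j))"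
    have F: "F (u *\<^sub>R q + v *\<^sub>R q') = u * F q + v * F q'" for u v q q'
      by (simp add: F_def lookup_add algebra_simps sum.distrib sum_distrib_left)
    have "convex {q. 1 \<le> F q}"
    proof (rule convexI)
      fix q q' and u v :: real
      assume "q \<in> {q. 1 \<le> F q}" "q' \<in> {q. 1 \<le> F q}" "0 \<le> u" "0 \<le> v" "u + v = 1"
      then show "u *\<^sub>R q + v *\<^sub>R q' \<in> {q. 1 \<le> F q}"
        using mult_left_mono[of 1 "F q" u] mult_left_mono[of 1 "F q'" v]
        unfolding F mem_Collect_eq by linarith
    qed
    moreover have "mixed_integer_set b k l r p \<subseteq> {q. 1 \<le> F q}"
    proof
      fix q assume mem: "q \<in> mixed_integer_set b k l r p"
      obtain s y where sy: "q = (s, y)" by (rule prod.exhaust)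
      have q: "\<forall>i<k. Poly_Mapping.lookup s i \<ge> 0"
        "\<forall>j<l. Poly_Mapping.lookup y j \<in> \<nat>"
        "(\<Sum>i<k. Poly_Mapping.lookup s i *\<^sub>R r i) + (\<Sum>j<l. Poly_Mapping.lookup y j *\<^sub>R p j)
         \<in> shifted_lattice b"
        using mem unfolding sy mixed_integer_set_def mem_Collect_eq case_prod_conv
        by - (elim conjE, assumption)+
      \<comment> \<open>The entries of \<open>y\<close> below \<open>l\<close> are natural numbers
        of type \<open>real\<close>, so the floor recovers them exactly; other indices never
        enter.\<close>
      define m where "m = (\<lambda>j. nat \<lfloor>Poly_Mapping.lookup y j\<rfloor>)"
      have m: "real (m j) = Poly_Mapping.lookup y j" if "j < l" for j
        using q(2) that by (auto simp: m_def elim!: Nats_cases)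
      have "(\<Sum>j<l. real (m j) *\<^sub>R p j) = (\<Sum>j<l. Poly_Mapping.lookup y j *\<^sub>R p j)"
        "(\<Sum>j<l. \<pi> (p j) * real (m j)) = (\<Sum>j<l. \<pi> (p j) * Poly_Mapping.lookup y j)"
        by (auto intro!: sum.cong simp: m)
      then show "q \<in> {q. 1 \<le> F q}"
        using R[rule_format, of k "Poly_Mapping.lookup s" r m p l] q(1,3)
        unfolding F_def sy mem_Collect_eq fst_conv snd_conv by (simp only:)
    qed
    ultimately have "convex hull (mixed_integer_set b k l r p) \<subseteq> {q. 1 \<le> F q}"
      by (rule hull_minimal[rotated])
    then show ?thesis
      using sy by (auto simp: F_def)
  qed
  then show "valid_pair b \<psi> \<pi>"
    unfolding valid_pair_def by blast
qed

lemma shifted_lattice_iff: "w \<in> shifted_lattice b \<longleftrightarrow> (\<forall>k. w $ k - b $ k \<in> \<int>)"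
proof
  assume "\<forall>k. w $ k - b $ k \<in> \<int>"
  then have "w - b \<in> int_lattice" by (simp add: int_lattice_def)
  then show "w \<in> shifted_lattice b" by (intro image_eqI[of _ _ "w - b"]) auto
qed (auto simp: int_lattice_def)

section \<open>Nonnegativity, minimal liftings, and liftings with one cheap point\<close>

text \<open>If \<open>\<pi> q\<close> were negative, a large multiple of \<open>q\<close> together with one continuous variable,
  whose cost stays bounded, would violate validity.\<close>

lemma lifting_nonneg:
  fixes b :: "real ^ 'n"
  assumes B: "0 \<in> interior B" and L: "lifting b B \<pi>"
  shows "0 \<le> \<pi> q"
proof (rule ccontr)
  assume neg: "\<not> 0 \<le> \<pi> q"
  obtain \<rho> where \<rho>: "\<rho> > 0" "cball 0 \<rho> \<subseteq> B"
    using B mem_interior_cball by blast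
  \<comment> \<open>Rounding \<open>N q\<close> to a shifted lattice point \<open>w\<close> leaves a
    remainder \<open>r\<close> of norm at most the dimension. Hence \<open>r /\<^sub>R K\<close>
    lies in the ball of radius \<open>\<rho>\<close>, and \<open>K\<close> bounds the gauge of
    \<open>r\<close> whatever \<open>N\<close> is.\<close>
  define K where "K = real CARD('n) / \<rho>"
  have K: "K > 0" using \<rho> by (simp add: K_def)
  obtain N :: nat where N: "K < real N * (- \<pi> q)"
    using reals_Archimedean3[of "- \<pi> q"] neg by auto
  define w where "w = (\<chi> k. b $ k + of_int \<lfloor>real N * q $ k - b $ k\<rfloor>)"
  define r where "r = w - real N *\<^sub>R q"
  have "\<bar>r $ k\<bar> \<le> 1" for k
    unfolding r_def w_def by simp linarith
  then have "(\<Sum>k\<in>UNIV. \<bar>r $ k\<bar>) \<le> real CARD('n)"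
    using sum_bounded_above[of UNIV "\<lambda>k. \<bar>r $ k\<bar>" 1] by simp
  then have "norm r \<le> real CARD('n)"
    using norm_le_l1_cart[of r] by linarith
  then have "r /\<^sub>R K \<in> cball 0 \<rho>"
    using \<rho> K by (simp add: K_def field_simps)
  then have "gauge_function B r \<le> K"
    unfolding gauge_function_def using K \<rho> by (intro cInf_lower bdd_belowI[of _ 0]) auto
  moreover have "w \<in> shifted_lattice b"
    by (simp add: shifted_lattice_iff w_def)
  then have "1 \<le> gauge_function B r + \<pi> q * real N"
    using L[unfolded lifting_def valid_pair_iff, rule_format, of 1 "\<lambda>_. 1" "\<lambda>_. r" "\<lambda>_. N" "\<lambda>_. q" 1]
    by (simp add: r_def)
  ultimately show False using N by (simp add: algebra_simps)
qed

text \<open>Each instance of the inequality involves only finitely many values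
  \<open>\<pi> (p j)\<close>, and a single member of a chain comes close to the infimum at all of
  these points at once.\<close>

lemma lifting_Inf_chain:
  fixes b :: "real ^ 'n"
  assumes B: "0 \<in> interior B" and "\<C> \<noteq> {}"
    and L: "\<And>\<pi>. \<pi> \<in> \<C> \<Longrightarrow> lifting b B \<pi>"
    and chain: "\<And>\<pi> \<pi>'. \<pi> \<in> \<C> \<Longrightarrow> \<pi>' \<in> \<C> \<Longrightarrow> \<pi> \<le> \<pi>' \<or> \<pi>' \<le> \<pi>"
  shows "lifting b B (\<lambda>x. INF \<pi>\<in>\<C>. \<pi> x)"
  unfolding lifting_def valid_pair_iff
proof (intro allI impI)
  fix k l r p and s :: "nat \<Rightarrow> real" and y :: "nat \<Rightarrow> nat"
  assume s: "\<forall>i<k. s i \<ge> 0"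
    and mem: "(\<Sum>i<k. s i *\<^sub>R r i) + (\<Sum>j<l. real (y j) *\<^sub>R p j) \<in> shifted_lattice b"
  define \<sigma> where "\<sigma> = (\<lambda>x. INF \<pi>\<in>\<C>. \<pi> x)"
  have "1 \<le> (\<Sum>i<k. gauge_function B (r i) * s i) + (\<Sum>j<l. \<sigma> (p j) * real (y j)) + e" if "e > 0" for e
  proof -
    \<comment> \<open>The slack \<open>e\<close> is shared among the integer variables; the summand
      1 keeps the denominator positive when all of them vanish.\<close>
    define d where "d = e / (1 + (\<Sum>j<l. real (y j)))"
    have pos: "1 + (\<Sum>j<l. real (y j)) > 0" by (smt (verit) of_nat_0_le_iff sum_nonneg)
    have d: "d > 0" "d * (\<Sum>j<l. real (y j)) \<le> e"
      using that pos by (auto simp: d_def field_simps)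
    \<comment> \<open>Of the member good for the first \<open>m\<close> points and the one good for
      the next point, the smaller is good for all of them.\<close>
    have "\<exists>\<pi>\<in>\<C>. \<forall>j<m. \<pi> (p j) \<le> \<sigma> (p j) + d" for m
    proof (induction m)
      case (Suc m)
      then obtain \<pi> where \<pi>: "\<pi> \<in> \<C>" "\<forall>j<m. \<pi> (p j) \<le> \<sigma> (p j) + d" by blast
      have "\<exists>v\<in>(\<lambda>\<pi>. \<pi> (p m)) ` \<C>. v < \<sigma> (p m) + d"
        unfolding \<sigma>_def using assms(2) d(1) by (intro cInf_lessD) auto
      then obtain \<pi>' where \<pi>': "\<pi>' \<in> \<C>" "\<pi>' (p m) < \<sigma> (p m) + d" by blast
      from chain[OF \<pi>(1) \<pi>'(1)] show ?case
      proof
        assume "\<pi> \<le> \<pi>'"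
        then have "\<pi> (p m) \<le> \<pi>' (p m)" by (simp add: le_fun_def)
        then show ?thesis using \<pi> \<pi>' by (intro bexI[of _ \<pi>]) (auto simp: less_Suc_eq)
      next
        assume "\<pi>' \<le> \<pi>"
        then have "\<pi>' (p j) \<le> \<pi> (p j)" for j by (simp add: le_fun_def)
        then show ?thesis using \<pi> \<pi>'
          by (intro bexI[of _ \<pi>']) (auto simp: less_Suc_eq intro: order_trans)
      qed
    qed (use assms(2) in auto)
    then obtain \<pi> where \<pi>: "\<pi> \<in> \<C>" "\<forall>j<l. \<pi> (p j) \<le> \<sigma> (p j) + d" by blast
    have "1 \<le> (\<Sum>i<k. gauge_function B (r i) * s i) + (\<Sum>j<l. \<pi> (p j) * real (y j))"
      using L[OF \<pi>(1)] s mem unfolding lifting_def valid_pair_iff by blast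
    also have "(\<Sum>j<l. \<pi> (p j) * real (y j)) \<le> (\<Sum>j<l. (\<sigma> (p j) + d) * real (y j))"
      using \<pi>(2) by (intro sum_mono mult_right_mono) auto
    also have "\<dots> = (\<Sum>j<l. \<sigma> (p j) * real (y j)) + d * (\<Sum>j<l. real (y j))"
      by (simp add: algebra_simps sum.distrib sum_distrib_left)
    finally show ?thesis using d(2) by linarith
  qed
  then show "1 \<le> (\<Sum>i<k. gauge_function B (r i) * s i)
      + (\<Sum>j<l. (INF \<pi>\<in>\<C>. \<pi> (p j)) * real (y j))"
    unfolding \<sigma>_def by (rule field_le_epsilon)
qed

text \<open>Zorn's lemma for the reversed pointwise order: a nonempty chain is bounded by its
  pointwise infimum, which is a genuine infimum because liftings are nonnegative.\<close>

lemma minimal_lifting_below: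
  fixes b :: "real ^ 'n"
  assumes B: "0 \<in> interior B" and \<pi>\<^sub>0: "lifting b B \<pi>\<^sub>0"
  obtains \<pi> where "minimal_lifting b B \<pi>" "\<pi> \<le> \<pi>\<^sub>0"
proof -
  define A where "A = {\<pi>. lifting b B \<pi> \<and> \<pi> \<le> \<pi>\<^sub>0}"
  have "\<exists>\<pi>\<in>A. \<forall>\<pi>'\<in>A. \<pi>' \<le> \<pi> \<longrightarrow> \<pi>' = \<pi>"
  proof (rule predicate_Zorn)
    show "partial_order_on A (relation_of (\<lambda>\<pi> \<pi>'. \<pi>' \<le> \<pi>) A)"
      by (auto simp: partial_order_on_def preorder_on_def refl_on_def trans_def antisym_def
          relation_of_def)
  next
    fix \<C> assume "\<C> \<in> Chains (relation_of (\<lambda>\<pi> \<pi>'. \<pi>' \<le> \<pi>) A)"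
    then have \<C>: "\<C> \<subseteq> A" "\<And>\<pi> \<pi>'. \<pi> \<in> \<C> \<Longrightarrow> \<pi>' \<in> \<C> \<Longrightarrow> \<pi> \<le> \<pi>' \<or> \<pi>' \<le> \<pi>"
      by (auto simp: Chains_def relation_of_def)
    show "\<exists>u\<in>A. \<forall>\<pi>\<in>\<C>. u \<le> \<pi>"
    proof (cases "\<C> = {}")
      case False
      define \<sigma> where "\<sigma> = (\<lambda>x. INF \<pi>\<in>\<C>. \<pi> x)"
      have L: "lifting b B \<pi>" "\<pi> \<le> \<pi>\<^sub>0" if "\<pi> \<in> \<C>" for \<pi>
        using \<C>(1) that by (auto simp: A_def)
      have le: "\<sigma> \<le> \<pi>" if "\<pi> \<in> \<C>" for \<pi>
        unfolding \<sigma>_def le_fun_def using that lifting_nonneg[OF B L(1)]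
        by (auto intro!: cINF_lower bdd_belowI2[where m = 0])
      have "lifting b B \<sigma>"
        unfolding \<sigma>_def using B False L(1) \<C>(2) by (rule lifting_Inf_chain)
      moreover have "\<sigma> \<le> \<pi>\<^sub>0"
        using False le L(2) order_trans by blast
      ultimately show ?thesis using le by (auto simp: A_def)
    qed (use \<pi>\<^sub>0 in \<open>auto simp: A_def\<close>)
  qed
  then obtain \<pi> where \<pi>: "lifting b B \<pi>" "\<pi> \<le> \<pi>\<^sub>0"
    and min: "\<And>\<pi>'. lifting b B \<pi>' \<Longrightarrow> \<pi>' \<le> \<pi>\<^sub>0 \<Longrightarrow> \<pi>' \<le> \<pi> \<Longrightarrow> \<pi>' = \<pi>"
    unfolding A_def by blast
  have "minimal_lifting b B \<pi>"
    unfolding minimal_lifting_def using \<pi> min by (metis le_funI order_trans)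
  then show thesis using \<pi>(2) that by blast
qed

text \<open>A positive integer variable on a column other than \<open>p\<close> already contributes
  1. Otherwise the integer part is \<open>N p\<close>, and sublinearity of the gauge replaces all
  continuous columns by the single vector \<open>w - N p\<close>, so \<open>key\<close>
  suffices.\<close>

lemma lifting_at_point:
  fixes b p :: "real ^ 'n"
  assumes sub: "\<And>x y. gauge_function B (x + y) \<le> gauge_function B x + gauge_function B y"
    and hom: "\<And>t x. t \<ge> 0 \<Longrightarrow> gauge_function B (t *\<^sub>R x) = t * gauge_function B x"
    and nonneg: "\<And>x. gauge_function B x \<ge> 0"
    and V: "V \<ge> 0"
    and key: "\<And>(N::nat) w. w \<in> shifted_lattice b \<Longrightarrow>
      1 \<le> real N * V + gauge_function B (w - real N *\<^sub>R p)"
  shows "lifting b B (\<lambda>x. if x = p then V else 1)"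
  unfolding lifting_def valid_pair_iff
proof (intro allI impI)
  fix k l r q and s :: "nat \<Rightarrow> real" and y :: "nat \<Rightarrow> nat"
  let ?\<psi> = "gauge_function B" and ?\<pi> = "\<lambda>x. if x = p then V else 1"
  assume s: "\<forall>i<k. s i \<ge> 0"
    and mem: "(\<Sum>i<k. s i *\<^sub>R r i) + (\<Sum>j<l. real (y j) *\<^sub>R q j) \<in> shifted_lattice b"
  have \<psi>0: "0 \<le> (\<Sum>i<k. ?\<psi> (r i) * s i)"
    using s nonneg by (intro sum_nonneg) auto
  show "1 \<le> (\<Sum>i<k. ?\<psi> (r i) * s i) + (\<Sum>j<l. ?\<pi> (q j) * real (y j))"
  proof (cases "\<exists>j<l. q j \<noteq> p \<and> y j \<noteq> 0")
    case True
    then obtain j where j: "j < l" "q j \<noteq> p" "y j \<noteq> 0" by blast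
    have "1 \<le> ?\<pi> (q j) * real (y j)" using j by simp
    also have "\<dots> \<le> (\<Sum>j<l. ?\<pi> (q j) * real (y j))"
      using V j(1) by (intro member_le_sum) auto
    finally show ?thesis using \<psi>0 by linarith
  next
    case False
    define N where "N = (\<Sum>j<l. y j)"
    have "(\<Sum>j<l. real (y j) *\<^sub>R q j) = (\<Sum>j<l. real (y j) *\<^sub>R p)"
      using False by (intro sum.cong) auto
    also have "\<dots> = real N *\<^sub>R p" by (simp add: N_def scaleR_sum_left)
    finally have q: "(\<Sum>j<l. real (y j) *\<^sub>R q j) = real N *\<^sub>R p" .
    have "(\<Sum>j<l. ?\<pi> (q j) * real (y j)) = (\<Sum>j<l. V * real (y j))"
      using False by (intro sum.cong) auto
    also have "\<dots> = real N * V" by (simp add: N_def sum_distrib_left mult.commute)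
    finally have \<pi>: "(\<Sum>j<l. ?\<pi> (q j) * real (y j)) = real N * V" .
    have "?\<psi> (\<Sum>i<m. s i *\<^sub>R r i) \<le> (\<Sum>i<m. ?\<psi> (r i) * s i)" if "m \<le> k" for m
      using that
    proof (induction m)
      case 0
      then show ?case using hom[of 0 0] by simp
    next
      case (Suc m)
      then show ?case
        using sub[of "\<Sum>i<m. s i *\<^sub>R r i" "s m *\<^sub>R r m"] hom[of "s m" "r m"] s
        by (auto simp: mult.commute)
    qed
    then have "?\<psi> (\<Sum>i<k. s i *\<^sub>R r i) \<le> (\<Sum>i<k. ?\<psi> (r i) * s i)" by simp
    moreover have "1 \<le> real N * V + ?\<psi> (\<Sum>i<k. s i *\<^sub>R r i)"
      using key[OF mem, of N] by (simp add: q)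
    ultimately show ?thesis by (simp add: \<pi>)
  qed
qed

section \<open>Intersections of two strips: gauge and maximality\<close>

lemma interior_strip:
  fixes c :: "'a :: euclidean_space"
  assumes "c \<noteq> 0"
  shows "interior {x. \<bar>c \<bullet> x\<bar> \<le> 1} = {x. \<bar>c \<bullet> x\<bar> < 1}"
proof -
  have "{x. \<bar>c \<bullet> x\<bar> \<le> 1} = {x. c \<bullet> x \<le> 1} \<inter> {x. (- c) \<bullet> x \<le> 1}"
    unfolding inner_minus_left by auto
  then have "interior {x. \<bar>c \<bullet> x\<bar> \<le> 1} = {x. c \<bullet> x < 1} \<inter> {x. (- c) \<bullet> x < 1}"
    using assms by (simp only: interior_Int interior_halfspace_le neg_equal_0_iff_equal not_False_eq_True)
  also have "\<dots> = {x. \<bar>c \<bullet> x\<bar> < 1}" unfolding inner_minus_left by auto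
  finally show ?thesis .
qed

text \<open>The admissible \<open>t\<close> are the positive numbers above the maximum. They form an
  open ray when the maximum is 0 and a closed one otherwise, whence the case split.\<close>

lemma gauge_strips:
  "gauge_function {x. \<bar>c \<bullet> x\<bar> \<le> 1 \<and> \<bar>d \<bullet> x\<bar> \<le> 1} x = max \<bar>c \<bullet> x\<bar> \<bar>d \<bullet> x\<bar>"
proof -
  let ?M = "max \<bar>c \<bullet> x\<bar> \<bar>d \<bullet> x\<bar>"
  have "{t. t > 0 \<and> x /\<^sub>R t \<in> {x. \<bar>c \<bullet> x\<bar> \<le> 1 \<and> \<bar>d \<bullet> x\<bar> \<le> 1}} = {t. t > 0 \<and> ?M \<le> t}"
    by (auto simp: abs_mult field_simps)
  also have "\<dots> = (if ?M = 0 then {0<..} else {?M..})" by auto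
  finally have eq: "{t. t > 0 \<and> x /\<^sub>R t \<in> {x. \<bar>c \<bullet> x\<bar> \<le> 1 \<and> \<bar>d \<bullet> x\<bar> \<le> 1}}
    = (if ?M = 0 then {0<..} else {?M..})" .
  show ?thesis
    unfolding gauge_function_def eq
    by (cases "?M = 0") (simp_all only: if_True if_False simp_thms cInf_greaterThan cInf_atLeast)
qed

text \<open>The point \<open>u\<close> lies in the relative interior of a facet that \<open>y\<close> violates, so it lies on a
  segment from \<open>y\<close> to an interior point.\<close>

lemma blocking_point_interior:
  fixes c d :: "'a :: euclidean_space"
  assumes C: "convex C" "{x. \<bar>c \<bullet> x\<bar> \<le> 1 \<and> \<bar>d \<bullet> x\<bar> \<le> 1} \<subseteq> C"
    and y: "y \<in> C" "c \<bullet> y > 1" and u: "c \<bullet> u = 1" "\<bar>d \<bullet> u\<bar> < 1"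
  shows "u \<in> interior C"
proof -
  \<comment> \<open>\<open>?q s\<close> runs from \<open>u\<close> away from \<open>y\<close>. Since
    \<open>c \<bullet> y > 1\<close>, this brings \<open>c\<close> below 1, and the other strict
    inequalities hold at \<open>s = 0\<close>, hence also for small positive
    \<open>s\<close>.\<close>
  let ?q = "\<lambda>s. u + s *\<^sub>R (u - y)"
  have "((\<lambda>s. c \<bullet> ?q s) \<longlongrightarrow> c \<bullet> ?q 0) (at_right 0)" "((\<lambda>s. \<bar>d \<bullet> ?q s\<bar>) \<longlongrightarrow> \<bar>d \<bullet> ?q 0\<bar>) (at_right 0)"
    by (intro tendsto_intros)+
  then have "\<forall>\<^sub>F s in at_right 0. c \<bullet> ?q s > -1" "\<forall>\<^sub>F s in at_right 0. \<bar>d \<bullet> ?q s\<bar> < 1"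
    using u by (auto intro: order_tendstoD)
  then have "\<forall>\<^sub>F s in at_right (0::real). s > 0 \<and> c \<bullet> ?q s > -1 \<and> \<bar>d \<bullet> ?q s\<bar> < 1"
    using eventually_at_right_less[of 0] by eventually_elim simp
  then obtain s :: real where s: "s > 0" "c \<bullet> ?q s > -1" "\<bar>d \<bullet> ?q s\<bar> < 1"
    using eventually_happens' trivial_limit_at_right_real by (metis (mono_tags, lifting))
  have "s * (1 - c \<bullet> y) < 0" using s(1) y(2) by (simp add: mult_pos_neg)
  then have "c \<bullet> ?q s < 1" using u by (simp add: inner_diff_right inner_add_right)
  then have "?q s \<in> {x. \<bar>c \<bullet> x\<bar> < 1} \<inter> {x. \<bar>d \<bullet> x\<bar> < 1}" using s by auto
  moreover have "open ({x. \<bar>c \<bullet> x\<bar> < 1} \<inter> {x. \<bar>d \<bullet> x\<bar> < 1})"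
    by (intro open_Int open_Collect_less continuous_intros)
  moreover have "{x. \<bar>c \<bullet> x\<bar> < 1} \<inter> {x. \<bar>d \<bullet> x\<bar> < 1} \<subseteq> C" using C(2) by auto
  ultimately have "?q s \<in> interior C" by (meson interiorI)
  then have "y - (1 / (1 + s)) *\<^sub>R (y - ?q s) \<in> interior C"
    using C(1) y(1) s(1) by (intro mem_interior_convex_shrink) auto
  moreover have "y - (1 / (1 + s)) *\<^sub>R (y - ?q s) = u"
  proof -
    have "y - ?q s = (1 + s) *\<^sub>R (y - u)" by (simp add: algebra_simps)
    then show ?thesis using s(1) by simp
  qed
  ultimately show ?thesis by simp
qed

text \<open>The points \<open>u\<close>, \<open>- u\<close>, \<open>v\<close>, \<open>- v\<close>
  block the four facets: a strictly larger convex set crosses some facet and so gets the blocking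
  point of that facet into its interior.\<close>

lemma maximal_lattice_free_strips:
  fixes b c d :: "real ^ 'n"
  assumes free: "\<And>w. w \<in> shifted_lattice b \<Longrightarrow> 1 \<le> \<bar>c \<bullet> w\<bar> \<or> 1 \<le> \<bar>d \<bullet> w\<bar>"
    and u: "u \<in> shifted_lattice b" "- u \<in> shifted_lattice b" "c \<bullet> u = 1" "\<bar>d \<bullet> u\<bar> < 1"
    and v: "v \<in> shifted_lattice b" "- v \<in> shifted_lattice b" "d \<bullet> v = 1" "\<bar>c \<bullet> v\<bar> < 1"
  shows "maximal_lattice_free b {x. \<bar>c \<bullet> x\<bar> \<le> 1 \<and> \<bar>d \<bullet> x\<bar> \<le> 1}" (is "maximal_lattice_free b ?B")
proof -
  have Int: "?B = {x. \<bar>c \<bullet> x\<bar> \<le> 1} \<inter> {x. \<bar>d \<bullet> x\<bar> \<le> 1}" by auto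
  have int: "interior ?B = {x. \<bar>c \<bullet> x\<bar> < 1} \<inter> {x. \<bar>d \<bullet> x\<bar> < 1}"
    unfolding Int interior_Int using u(3) v(3) by (subst (1 2) interior_strip) auto
  have "closed ?B"
    unfolding Int by (intro closed_Int closed_Collect_le continuous_intros)
  moreover have "?B = {x. c \<bullet> x \<le> 1} \<inter> {x. c \<bullet> x \<ge> -1} \<inter> {x. d \<bullet> x \<le> 1} \<inter> {x. d \<bullet> x \<ge> -1}"
    by auto
  then have "convex ?B"
    by (simp add: convex_Int convex_halfspace_le convex_halfspace_ge)
  moreover have "interior ?B \<inter> shifted_lattice b = {}"
    unfolding int using free by fastforce
  ultimately have "lattice_free b ?B"
    by (simp add: lattice_free_def int)
  moreover have False if C: "lattice_free b C" "?B \<subset> C" for C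
  proof -
    obtain y where y: "y \<in> C" "y \<notin> ?B" using C(2) by blast
    have conv: "convex C" and none: "\<And>w. w \<in> shifted_lattice b \<Longrightarrow> w \<notin> interior C"
      using C(1) by (auto simp: lattice_free_def)
    \<comment> \<open>The strips are unchanged when \<open>c\<close> or \<open>d\<close> changes
      sign, so the same argument treats opposite facets.\<close>
    consider "c \<bullet> y > 1" | "(- c) \<bullet> y > 1" | "d \<bullet> y > 1" | "(- d) \<bullet> y > 1"
      using y(2) by fastforce
    then show False
    proof cases
      case 1
      show ?thesis using blocking_point_interior[OF conv _ y(1) 1 u(3,4)] none[OF u(1)] C(2) by blast
    next
      case 2
      show ?thesis
        using blocking_point_interior[OF conv _ y(1) 2, of d "- u"] u(3,4) none[OF u(2)] C(2) by auto
    next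
      case 3
      show ?thesis
        using blocking_point_interior[OF conv _ y(1) 3, of c v] v(3,4) none[OF v(1)] C(2) by auto
    next
      case 4
      show ?thesis
        using blocking_point_interior[OF conv _ y(1) 4, of c "- v"] v(3,4) none[OF v(2)] C(2) by auto
    qed
  qed
  ultimately show ?thesis
    unfolding maximal_lattice_free_def by blast
qed

section \<open>The parallelogram over half-integers\<close>

lemma abs_half_odd_ge:
  fixes x :: real
  assumes "x - 1/2 \<in> \<int>"
  shows "1/2 \<le> \<bar>x\<bar>"
proof -
  obtain m where "x - 1/2 = of_int m" using assms by (auto elim: Ints_cases)
  then have x: "x = of_int m + 1/2" by simp
  have "m \<ge> 0 \<or> m \<le> -1" by linarith
  then have "(of_int m :: real) \<ge> 0 \<or> (of_int m :: real) \<le> -1" by linarith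
  then show ?thesis using x by linarith
qed

lemma abs_half_integer_ge:
  fixes x :: real
  assumes "2 * x \<in> \<int>" "x \<noteq> 0"
  shows "1/2 \<le> \<bar>x\<bar>"
  using Ints_nonzero_abs_ge1[OF assms(1)] assms(2) by (simp add: abs_mult)

text \<open>For opposite signs the absolute values add up in \<open>u - v\<close>. For equal signs
  they add up in the other form, whose coefficients are positive with sum 2.\<close>

lemma parallelogram_ge_one:
  fixes u v :: real
  assumes "0 < e" "e < 1" "1/2 \<le> \<bar>u\<bar>" "1/2 \<le> \<bar>v\<bar>"
  shows "1 \<le> \<bar>u - v\<bar> \<or> 1 \<le> \<bar>(2 - e) * u + e * v\<bar>"
proof (cases "u * v > 0")
  case True
  then have "\<bar>(2 - e) * u + e * v\<bar> = (2 - e) * \<bar>u\<bar> + e * \<bar>v\<bar>"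
  proof -
    consider "u > 0" "v > 0" | "u < 0" "v < 0" using True by (auto simp: zero_less_mult_iff)
    then show ?thesis
    proof cases
      case 1
      then have "(2 - e) * u > 0" "e * v > 0" using assms by simp_all
      then show ?thesis using 1 by simp
    next
      case 2
      then have "(2 - e) * u < 0" "e * v < 0" using assms by (simp_all add: mult_pos_neg)
      then show ?thesis using 2 by simp
    qed
  qed
  moreover have "(2 - e) * \<bar>u\<bar> \<ge> (2 - e) * (1/2)" "e * \<bar>v\<bar> \<ge> e * (1/2)"
    using assms by (intro mult_left_mono; simp)+
  ultimately show ?thesis by argo
next
  case False
  then have "\<bar>u - v\<bar> = \<bar>u\<bar> + \<bar>v\<bar>" by (auto simp: not_less mult_le_0_iff)
  then show ?thesis using assms by simp
qed

text \<open>The parallelogram needs two distinct coordinates, hence the assumption on the dimension.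
  Nonemptiness of \<open>\<F>\<close> rules out a vacuous family, and the nonzero denominator rules
  out the convention that division by 0 gives 0.\<close>

theorem theorem1p5:
  fixes \<epsilon> :: real
  assumes "CARD('n::finite) \<ge> 2" and "\<epsilon> > 0"
  shows "\<exists>(b :: real ^ 'n) \<F>. b \<notin> int_lattice \<and> \<F> \<noteq> {} \<and>
    (\<forall>B\<in>\<F>. maximal_lattice_free b B) \<and>
    (\<forall>B\<in>\<F>. \<exists>\<pi> p. minimal_lifting b B \<pi> \<and>
       trivial_lifting B p \<noteq> 0 \<and> \<pi> p / trivial_lifting B p < \<epsilon>)"
proof -
  obtain i j :: 'n where ij: "i \<noteq> j"
    using obtain_subset_with_card_n[OF assms(1)] by (metis card_2_iff)
  \<comment> \<open>The final ratio is at most \<open>(e/2) / (1/2) = e\<close>, so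
    \<open>e < \<epsilon>\<close> is enough; \<open>e < 1\<close> keeps \<open>2 - e\<close>
    positive.\<close>
  define e where "e = min 1 \<epsilon> / 2"
  have e: "0 < e" "e < 1" "e < \<epsilon>" using assms(2) by (auto simp: e_def)
  define b :: "real ^ 'n" where "b = (\<chi> k. 1/2)"
  define c :: "real ^ 'n" where "c = axis i 1 - axis j 1"
  define d :: "real ^ 'n" where "d = (2 - e) *\<^sub>R axis i 1 + e *\<^sub>R axis j 1"
  define p :: "real ^ 'n" where "p = axis j (1/2)"
  define B where "B = {x. \<bar>c \<bullet> x\<bar> \<le> 1 \<and> \<bar>d \<bullet> x\<bar> \<le> 1}"
  have ax: "axis k 1 \<bullet> x = x $ k" for k and x :: "real ^ 'n"
    by (simp add: inner_axis')
  have c: "c \<bullet> x = x $ i - x $ j" for x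
    by (simp add: c_def inner_diff_left ax)
  have d: "d \<bullet> x = (2 - e) * x $ i + e * x $ j" for x
    by (simp add: d_def inner_add_left ax)
  have half: "1/2 \<notin> (\<int> :: real set)" using abs_half_odd_ge[of 0] Ints_minus[of "1/2::real"] by auto
  have b: "b \<notin> int_lattice" using half by (auto simp: int_lattice_def b_def)
  have lat: "w \<in> shifted_lattice b \<longleftrightarrow> (\<forall>k. w $ k - 1/2 \<in> \<int>)" for w
    by (simp add: shifted_lattice_iff b_def)
  \<comment> \<open>\<open>u\<close> blocks the facet \<open>c \<bullet> x = 1\<close>, with
    \<open>d \<bullet> u = 1 - e\<close>; \<open>v\<close> blocks \<open>d \<bullet> x = 1\<close>,
    with \<open>c \<bullet> v = 0\<close>.\<close>
  define u :: "real ^ 'n" where "u = (\<chi> k. if k = j then - (1/2) else 1/2)"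
  define v :: "real ^ 'n" where "v = (\<chi> k. 1/2)"
  have max: "maximal_lattice_free b B"
    unfolding B_def
  proof (rule maximal_lattice_free_strips[where u = u and v = v])
    show "1 \<le> \<bar>c \<bullet> w\<bar> \<or> 1 \<le> \<bar>d \<bullet> w\<bar>" if "w \<in> shifted_lattice b" for w
      using that e parallelogram_ge_one abs_half_odd_ge unfolding lat c d by blast
    show "u \<in> shifted_lattice b" "- u \<in> shifted_lattice b"
      "v \<in> shifted_lattice b" "- v \<in> shifted_lattice b"
      unfolding lat by (simp_all add: u_def v_def)
    have "d \<bullet> u = 1 - e" "d \<bullet> v = 1"
      using ij by (simp_all add: d u_def v_def diff_divide_distrib)
    then show "\<bar>d \<bullet> u\<bar> < 1" "d \<bullet> v = 1" using e by simp_all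
    show "c \<bullet> u = 1" "\<bar>c \<bullet> v\<bar> < 1"
      using ij by (simp_all add: c u_def v_def)
  qed
  have gauge: "gauge_function B x = max \<bar>c \<bullet> x\<bar> \<bar>d \<bullet> x\<bar>" for x
    unfolding B_def by (rule gauge_strips)
  have "lifting b B (\<lambda>x. if x = p then e / 2 else 1)"
  proof (rule lifting_at_point)
    show "gauge_function B (x + y) \<le> gauge_function B x + gauge_function B y" for x y
      unfolding gauge inner_add_right by (auto simp: max_def)
    show "gauge_function B (t *\<^sub>R x) = t * gauge_function B x" if "t \<ge> 0" for t x
      using that by (simp add: gauge abs_mult max_mult_distrib_left)
    show "1 \<le> real N * (e / 2) + gauge_function B (w - real N *\<^sub>R p)"
      if w: "w \<in> shifted_lattice b" for N w
    proof -
      define x where "x = w - real N *\<^sub>R p"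
      have x: "x $ i = w $ i" "x $ j = w $ j - real N / 2"
        using ij by (auto simp: x_def p_def axis_def)
      have wi: "1/2 \<le> \<bar>x $ i\<bar>" using w abs_half_odd_ge by (auto simp: lat x)
      show ?thesis
      \<comment> \<open>Coordinate \<open>j\<close> of \<open>x\<close> is a multiple of 1/2. If it
        is nonzero, the gauge alone reaches 1. If it is 0, the gauge is still at least
        \<open>1 - e/2\<close>, and the missing \<open>e/2\<close> is paid by
        \<open>N \<ge> 1\<close> copies of \<open>p\<close>.\<close>
      proof (cases "x $ j = 0")
        case False
        have "w $ j - 1/2 \<in> \<int>" using w lat by blast
        then have "2 * (w $ j - 1/2) + (1 - of_nat N) \<in> \<int>"
          by (intro Ints_add[OF Ints_mult]) auto
        then have "2 * x $ j \<in> \<int>" by (simp add: x algebra_simps)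
        then have "1/2 \<le> \<bar>x $ j\<bar>" using False by (rule abs_half_integer_ge)
        then have "1 \<le> gauge_function B x"
          using parallelogram_ge_one[OF e(1,2) wi, of "x $ j"] by (auto simp: gauge c d max_def)
        moreover have "0 \<le> real N * (e / 2)" using e by simp
        ultimately show ?thesis unfolding x_def by linarith
      next
        case True
        have "N \<noteq> 0"
        proof
          assume "N = 0"
          then have "w $ j = 0" using True x by simp
          moreover have "1/2 \<le> \<bar>w $ j\<bar>" using w by (intro abs_half_odd_ge) (simp only: lat)
          ultimately show False by simp
        qed
        then have "e / 2 \<le> real N * (e / 2)" using e by simp
        moreover have "(2 - e) * (1/2) \<le> (2 - e) * \<bar>x $ i\<bar>"
          using wi e by (intro mult_left_mono) auto
        moreover have "(2 - e) * \<bar>x $ i\<bar> \<le> gauge_function B x"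
          using e by (simp add: gauge d True abs_mult)
        ultimately show ?thesis unfolding x_def[symmetric] by argo
      qed
    qed
  qed (use e in \<open>auto simp: gauge\<close>)
  moreover have B0: "0 \<in> interior B"
    using max by (simp add: maximal_lattice_free_def lattice_free_def)
  ultimately obtain \<pi> where \<pi>: "minimal_lifting b B \<pi>" "\<pi> \<le> (\<lambda>x. if x = p then e / 2 else 1)"
    using minimal_lifting_below by blast
  have \<pi>p: "\<pi> p \<le> e / 2" using le_funD[OF \<pi>(2), of p] by simp
  \<comment> \<open>The form \<open>c\<close> alone suffices: on \<open>p + z\<close> it takes a
    half-odd value.\<close>
  have "1/2 \<le> gauge_function B (p + z)" if "z \<in> int_lattice" for z
  proof -
    have "z $ j - z $ i \<in> \<int>" using that by (simp add: int_lattice_def)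
    then have "1/2 \<le> \<bar>z $ j - z $ i + 1/2\<bar>" by (intro abs_half_odd_ge) simp
    moreover have "\<bar>c \<bullet> (p + z)\<bar> = \<bar>z $ j - z $ i + 1/2\<bar>"
      using ij by (simp add: c p_def axis_def)
    ultimately show ?thesis unfolding gauge by linarith
  qed
  moreover have "int_lattice \<noteq> ({} :: (real ^ 'n) set)"
    by (auto simp: int_lattice_def intro!: exI[of _ 0])
  ultimately have "1/2 \<le> (INF z\<in>int_lattice. gauge_function B (p + z))"
    by (intro cINF_greatest)
  then have triv: "1/2 \<le> trivial_lifting B p" by (simp add: trivial_lifting_def)
  have "\<pi> p / trivial_lifting B p \<le> e"
  proof -
    have "e * (1/2) \<le> e * trivial_lifting B p" using triv e by (intro mult_left_mono) auto
    then show ?thesis using \<pi>p triv by (simp add: divide_le_eq)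
  qed
  then have "trivial_lifting B p \<noteq> 0 \<and> \<pi> p / trivial_lifting B p < \<epsilon>"
    using triv e by auto
  then show ?thesis
    using b max \<pi>(1) by (intro exI[of _ b] exI[of _ "{B}"]) blast
qed

end
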